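(* Let $L=\mathrm{Log}(\mathcal F_L)$ be a tabular quasi-normal modal logic where $\mathcal F_L=\{(\mathfrak F_1,0),\dots,(\mathfrak F_n,0)\}$ is a reduced set of finite rooted frames. Then the following are equivalent: (1) $L$ has the Craig interpolation property; (2) for every signature $\sigma$: whenever $\mathfrak M,0\sim_\sigma\mathfrak N,0$ with $\mathfrak M$ a model based on $\mathfrak F_i$ and $\mathfrak N$ a model based on $\mathfrak F_j$, the $\sigma$-reducts of $(\mathfrak M,0)$ and $(\mathfrak N,0)$ are isomorphic (in particular $i=j$).
   Context: Modal formulas over atoms with $\top,\neg,\wedge,\Box$; $\mathrm{sig}$ = set of atoms; a signature is a finite set of atoms. A frame $(W,R)$ is rooted at $0$ if every world is $R$-reachable from $0$. $\mathrm{Log}(\mathcal F)$ for a set of pointed frames is the set of formulas valid at the distinguished world under all valuations. Quasi-normal modal logic: set of modal formulas containing all formulas valid in all pointed frames, closed under modus ponens and uniform substitution; tabular if it is $\mathrm{Log}$ of a finite set of finite pointed frames. $\mathcal F_L$ is reduced if $\mathrm{Log}(\mathfrak F_i,0)\not\subseteq\mathrm{Log}(\mathfrak F_j,0)$ for $i\neq j$. $L$ has the Craig interpolation property if for all $\varphi\to\psi\in L$ there is $\chi$ with $\varphi\to\chi\in L$, $\chi\to\psi\in L$, $\mathrm{sig}(\chi)\subseteq\mathrm{sig}(\varphi)\cap\mathrm{sig}(\psi)$. A $\sigma$-bisimulation between models $\mathfrak M_1,\mathfrak M_2$ is a relation $Z\subseteq W_1\times W_2$ such that related worlds agree on all atoms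 in $\sigma$, and (forth) if $w_1Zw_2$ and $w_1R_1v_1$ then there is $v_2$ with $w_2R_2v_2$ and $v_1Zv_2$, and (back) symmetrically; $\mathfrak M_1,w_1\sim_\sigma\mathfrak M_2,w_2$ means some $\sigma$-bisimulation relates $w_1$ and $w_2$. An isomorphism between the $\sigma$-reducts of pointed models $(\mathfrak M_1,w_1)$ and $(\mathfrak M_2,w_2)$ is a frame isomorphism $f$ with $f(w_1)=w_2$ such that $\mathfrak M_1,w\models p$ iff $\mathfrak M_2,f(w)\models p$ for all worlds $w$ and all $p\in\sigma$. *)

theory Defs
  imports Main
begin

text \<open>Atoms are drawn from the countably infinite type \<^typ>\<open>nat\<close>;
  a signature is a finite set of atoms.\<close>

type_synonym atom = nat

datatype fm = Atom atom | Top | Neg fm | And fm fm | Box fm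

abbreviation Imp :: "fm \<Rightarrow> fm \<Rightarrow> fm" where
  "Imp \<phi> \<psi> \<equiv> Neg (And \<phi> (Neg \<psi>))"

primrec sig :: "fm \<Rightarrow> atom set" where
  "sig (Atom p) = {p}"
| "sig Top = {}"
| "sig (Neg \<phi>) = sig \<phi>"
| "sig (And \<phi> \<psi>) = sig \<phi> \<union> sig \<psi>"
| "sig (Box \<phi>) = sig \<phi>"

primrec subst :: "(atom \<Rightarrow> fm) \<Rightarrow> fm \<Rightarrow> fm" where
  "subst s (Atom p) = s p"
| "subst s Top = Top"
| "subst s (Neg \<phi>) = Neg (subst s \<phi>)"
| "subst s (And \<phi> \<psi>) = And (subst s \<phi>) (subst s \<psi>)"
| "subst s (Box \<phi>) = Box (subst s \<phi>)"

record 'w frame =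
  worlds :: "'w set"
  rel :: "('w \<times> 'w) set"

definition is_frame :: "'w frame \<Rightarrow> bool" where
  "is_frame F \<longleftrightarrow> worlds F \<noteq> {} \<and> rel F \<subseteq> worlds F \<times> worlds F"

definition finite_frame :: "'w frame \<Rightarrow> bool" where
  "finite_frame F \<longleftrightarrow> is_frame F \<and> finite (worlds F)"

type_synonym 'w pointed_frame = "'w frame \<times> 'w"

definition is_pointed_frame :: "'w pointed_frame \<Rightarrow> bool" where
  "is_pointed_frame P \<longleftrightarrow> is_frame (fst P) \<and> snd P \<in> worlds (fst P)"

definition rooted_at :: "'w frame \<Rightarrow> 'w \<Rightarrow> bool" where
  "rooted_at F r \<longleftrightarrow> r \<in> worlds F \<and> (\<forall>w \<in> worlds F. (r, w) \<in> (rel F)\<^sup>*)"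

type_synonym 'w model = "'w frame \<times> (atom \<Rightarrow> 'w set)"

definition based_on :: "'w model \<Rightarrow> 'w frame \<Rightarrow> bool" where
  "based_on M F \<longleftrightarrow> fst M = F \<and> (\<forall>p. snd M p \<subseteq> worlds F)"

primrec sat :: "'w model \<Rightarrow> 'w \<Rightarrow> fm \<Rightarrow> bool" where
  "sat M w (Atom p) \<longleftrightarrow> w \<in> snd M p"
| "sat M w Top \<longleftrightarrow> True"
| "sat M w (Neg \<phi>) \<longleftrightarrow> \<not> sat M w \<phi>"
| "sat M w (And \<phi> \<psi>) \<longleftrightarrow> sat M w \<phi> \<and> sat M w \<psi>"
| "sat M w (Box \<phi>) \<longleftrightarrow> (\<forall>v. (w, v) \<in> rel (fst M) \<longrightarrow> sat M v \<phi>)"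

definition valid_at :: "'w pointed_frame \<Rightarrow> fm \<Rightarrow> bool" where
  "valid_at P \<phi> \<longleftrightarrow> (\<forall>M. based_on M (fst P) \<longrightarrow> sat M (snd P) \<phi>)"

definition Log :: "'w pointed_frame set \<Rightarrow> fm set" where
  "Log C = {\<phi>. \<forall>P \<in> C. valid_at P \<phi>}"

text \<open>HOL cannot quantify over frames of all types at once. A formula refutable in some pointed
  frame is refutable in a finite one, hence in one whose worlds are natural numbers, so
  ranging over \<^typ>\<open>nat\<close> below loses nothing; likewise for the finite frames in \<open>tabular\<close>
  (see \<open>tabular_Log\<close>).\<close>

definition quasi_normal :: "fm set \<Rightarrow> bool" where
  "quasi_normal L \<longleftrightarrow>
     {\<phi>. \<forall>P :: nat pointed_frame. is_pointed_frame P \<longrightarrow> valid_at P \<phi>} \<subseteq> L \<and>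
     (\<forall>\<phi> \<psi>. \<phi> \<in> L \<longrightarrow> Imp \<phi> \<psi> \<in> L \<longrightarrow> \<psi> \<in> L) \<and>
     (\<forall>\<phi> s. \<phi> \<in> L \<longrightarrow> subst s \<phi> \<in> L)"

definition tabular :: "fm set \<Rightarrow> bool" where
  "tabular L \<longleftrightarrow> (\<exists>C :: nat pointed_frame set. finite C \<and>
     (\<forall>P \<in> C. is_pointed_frame P \<and> finite_frame (fst P)) \<and> L = Log C)"

definition reduced :: "'i set \<Rightarrow> ('i \<Rightarrow> 'w pointed_frame) \<Rightarrow> bool" where
  "reduced I P \<longleftrightarrow> (\<forall>i \<in> I. \<forall>j \<in> I. i \<noteq> j \<longrightarrow> \<not> Log {P i} \<subseteq> Log {P j})"

definition craig_interpolation :: "fm set \<Rightarrow> bool" where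
  "craig_interpolation L \<longleftrightarrow> (\<forall>\<phi> \<psi>. Imp \<phi> \<psi> \<in> L \<longrightarrow>
     (\<exists>\<chi>. Imp \<phi> \<chi> \<in> L \<and> Imp \<chi> \<psi> \<in> L \<and> sig \<chi> \<subseteq> sig \<phi> \<inter> sig \<psi>))"

definition bisimulation ::
  "atom set \<Rightarrow> 'v model \<Rightarrow> 'w model \<Rightarrow> ('v \<times> 'w) set \<Rightarrow> bool" where
  "bisimulation \<sigma> M N Z \<longleftrightarrow>
     Z \<subseteq> worlds (fst M) \<times> worlds (fst N) \<and>
     (\<forall>(w, v) \<in> Z.
        (\<forall>p \<in> \<sigma>. w \<in> snd M p \<longleftrightarrow> v \<in> snd N p) \<and>
        (\<forall>w'. (w, w') \<in> rel (fst M) \<longrightarrow> (\<exists>v'. (v, v') \<in> rel (fst N) \<and> (w', v') \<in> Z)) \<and>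
        (\<forall>v'. (v, v') \<in> rel (fst N) \<longrightarrow> (\<exists>w'. (w, w') \<in> rel (fst M) \<and> (w', v') \<in> Z)))"

definition bisimilar :: "atom set \<Rightarrow> 'v model \<times> 'v \<Rightarrow> 'w model \<times> 'w \<Rightarrow> bool" where
  "bisimilar \<sigma> A B \<longleftrightarrow> (\<exists>Z. bisimulation \<sigma> (fst A) (fst B) Z \<and> (snd A, snd B) \<in> Z)"

definition frame_iso :: "('v \<Rightarrow> 'w) \<Rightarrow> 'v frame \<Rightarrow> 'w frame \<Rightarrow> bool" where
  "frame_iso f F G \<longleftrightarrow> bij_betw f (worlds F) (worlds G) \<and>
     (\<forall>w \<in> worlds F. \<forall>v \<in> worlds F. (w, v) \<in> rel F \<longleftrightarrow> (f w, f v) \<in> rel G)"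

definition reducts_isomorphic :: "atom set \<Rightarrow> 'v model \<times> 'v \<Rightarrow> 'w model \<times> 'w \<Rightarrow> bool" where
  "reducts_isomorphic \<sigma> A B \<longleftrightarrow> (\<exists>f. frame_iso f (fst (fst A)) (fst (fst B)) \<and>
     f (snd A) = snd B \<and>
     (\<forall>w \<in> worlds (fst (fst A)). \<forall>p \<in> \<sigma>. w \<in> snd (fst A) p \<longleftrightarrow> f w \<in> snd (fst B) p))"

lemma sat_iso:
  assumes "frame_iso f (fst M) (fst N)" "is_frame (fst M)" "is_frame (fst N)"
    and "\<And>w p. w \<in> worlds (fst M) \<Longrightarrow> w \<in> snd M p \<longleftrightarrow> f w \<in> snd N p"
    and "w \<in> worlds (fst M)"
  shows "sat M w \<phi> \<longleftrightarrow> sat N (f w) \<phi>"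
  using assms(5)
proof (induction \<phi> arbitrary: w)
  case (Box \<phi>)
  have f: "f ` worlds (fst M) = worlds (fst N)"
    using assms(1) by (auto simp: frame_iso_def bij_betw_def)
  have r: "(w, v) \<in> rel (fst M) \<longleftrightarrow> (f w, f v) \<in> rel (fst N)" if "v \<in> worlds (fst M)" for v
    using assms(1) that Box.prems by (auto simp: frame_iso_def)
  have sM: "v \<in> worlds (fst M)" if "(w, v) \<in> rel (fst M)" for v
    using assms(2) that by (auto simp: is_frame_def)
  have sN: "v \<in> f ` worlds (fst M)" if "(f w, v) \<in> rel (fst N)" for v
    using assms(3) that f by (auto simp: is_frame_def)
  show ?case
  proof
    assume L: "sat M w (Box \<phi>)"
    have "sat N v \<phi>" if v: "(f w, v) \<in> rel (fst N)" for v
    proof -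
      obtain u where u: "v = f u" "u \<in> worlds (fst M)" using sN[OF v] by blast
      then have "(w, u) \<in> rel (fst M)" using r v by blast
      then have "sat M u \<phi>" using L by simp
      then show ?thesis using Box.IH u by blast
    qed
    then show "sat N (f w) (Box \<phi>)" by simp
  next
    assume R: "sat N (f w) (Box \<phi>)"
    have "sat M v \<phi>" if v: "(w, v) \<in> rel (fst M)" for v
    proof -
      have "sat N (f v) \<phi>" using R r[OF sM[OF v]] v by simp
      then show ?thesis using Box.IH sM[OF v] by blast
    qed
    then show "sat M w (Box \<phi>)" by simp
  qed
qed (use assms(4) in simp_all)

lemma valid_at_iso:
  assumes "frame_iso f F G" "is_frame F" "is_frame G" "r \<in> worlds F"
  shows "valid_at (F, r) \<phi> \<longleftrightarrow> valid_at (G, f r) \<phi>"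
proof
  have inj: "inj_on f (worlds F)" and im: "f ` worlds F = worlds G"
    using assms(1) by (auto simp: frame_iso_def bij_betw_def)
  assume L: "valid_at (F, r) \<phi>"
  show "valid_at (G, f r) \<phi>"
    unfolding valid_at_def
  proof (intro allI impI)
    fix N assume N: "based_on N (fst (G, f r))"
    let ?M = "(F, \<lambda>p. {w \<in> worlds F. f w \<in> snd N p})"
    have "sat ?M r \<phi>" using L by (auto simp: valid_at_def based_on_def)
    moreover have "sat ?M r \<phi> \<longleftrightarrow> sat N (f r) \<phi>"
      by (rule sat_iso[where f = f]) (use assms N in \<open>auto simp: based_on_def\<close>)
    ultimately show "sat N (snd (G, f r)) \<phi>" by simp
  qed
next
  have inj: "inj_on f (worlds F)" and im: "f ` worlds F = worlds G"
    using assms(1) by (auto simp: frame_iso_def bij_betw_def)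
  assume R: "valid_at (G, f r) \<phi>"
  show "valid_at (F, r) \<phi>"
    unfolding valid_at_def
  proof (intro allI impI)
    fix M assume M: "based_on M (fst (F, r))"
    let ?N = "(G, \<lambda>p. f ` snd M p)"
    have "sat ?N (f r) \<phi>"
    proof -
      have "f ` snd M p \<subseteq> worlds G" for p
        using M im image_mono[of "snd M p" "worlds F" f] by (simp add: based_on_def)
      then have "based_on ?N G" by (simp add: based_on_def)
      then show ?thesis using R by (simp add: valid_at_def)
    qed
    moreover have "sat M r \<phi> \<longleftrightarrow> sat ?N (f r) \<phi>"
    proof (rule sat_iso[where f = f])
      show "w \<in> snd M p \<longleftrightarrow> f w \<in> snd ?N p" if "w \<in> worlds (fst M)" for w p
        using inj_on_image_mem_iff[OF inj, of w "snd M p"] that M by (auto simp: based_on_def)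
    qed (use assms M in \<open>auto simp: based_on_def\<close>)
    ultimately show "sat M (snd (F, r)) \<phi>" by simp
  qed
qed

lemma sat_subst:
  assumes "is_frame (fst M)" "w \<in> worlds (fst M)"
  shows "sat M w (subst s \<phi>) \<longleftrightarrow>
    sat (fst M, \<lambda>p. {v \<in> worlds (fst M). sat M v (s p)}) w \<phi>"
  using assms(2)
proof (induction \<phi> arbitrary: w)
  case (Box \<phi>)
  then show ?case using assms(1) unfolding is_frame_def by auto
qed auto

lemma quasi_normal_Log:
  assumes "\<forall>P \<in> C. is_pointed_frame (P :: nat pointed_frame)"
  shows "quasi_normal (Log C)"
  unfolding quasi_normal_def
proof (intro conjI allI impI)
  show "{\<phi>. \<forall>P :: nat pointed_frame. is_pointed_frame P \<longrightarrow> valid_at P \<phi>} \<subseteq> Log C"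
    using assms by (auto simp: Log_def)
  show "\<psi> \<in> Log C" if "\<phi> \<in> Log C" "Imp \<phi> \<psi> \<in> Log C" for \<phi> \<psi>
    using that by (auto simp: Log_def valid_at_def)
  show "subst s \<phi> \<in> Log C" if "\<phi> \<in> Log C" for \<phi> s
    using that assms unfolding Log_def valid_at_def
    by (clarsimp simp: is_pointed_frame_def)
       (subst sat_subst, auto simp: based_on_def)
qed

lemma tabular_Log:
  fixes C :: "'w pointed_frame set"
  assumes "finite C" "\<forall>P \<in> C. is_pointed_frame P \<and> finite_frame (fst P)"
  shows "tabular (Log C)" "quasi_normal (Log C)"
proof -
  have "\<exists>Q :: nat pointed_frame. is_pointed_frame Q \<and> finite_frame (fst Q) \<and>
      (\<forall>\<phi>. valid_at P \<phi> \<longleftrightarrow> valid_at Q \<phi>)" if "P \<in> C" for P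
  proof -
    obtain F r where P: "P = (F, r)" by (cases P)
    have F: "is_frame F" "finite (worlds F)" "r \<in> worlds F"
      using assms(2) that P by (auto simp: is_pointed_frame_def finite_frame_def)
    obtain f :: "'w \<Rightarrow> nat" where f: "inj_on f (worlds F)"
      using finite_imp_inj_to_nat_seg[OF F(2)] by blast
    let ?G = "\<lparr>worlds = f ` worlds F, rel = map_prod f f ` rel F\<rparr> :: nat frame"
    have G: "is_frame ?G" using F(1) by (auto simp: is_frame_def)
    have iso: "frame_iso f F ?G"
      unfolding frame_iso_def bij_betw_def
    proof (intro conjI ballI)
      fix w v assume wv: "w \<in> worlds F" "v \<in> worlds F"
      have "(w, v) \<in> rel F" if "(a, b) \<in> rel F" "f w = f a" "f v = f b" for a b
      proof -
        have "a \<in> worlds F" "b \<in> worlds F" using F(1) that(1) by (auto simp: is_frame_def)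
        then show ?thesis using that wv f by (metis inj_onD)
      qed
      then show "(w, v) \<in> rel F \<longleftrightarrow> (f w, f v) \<in> rel ?G" by force
    qed (use f in simp_all)
    show ?thesis
      using valid_at_iso[OF iso F(1) G F(3)] G F
      by (intro exI[of _ "(?G, f r)"]) (auto simp: P is_pointed_frame_def finite_frame_def)
  qed
  then obtain q :: "'w pointed_frame \<Rightarrow> nat pointed_frame" where
    q: "\<And>P. P \<in> C \<Longrightarrow> is_pointed_frame (q P) \<and> finite_frame (fst (q P)) \<and>
      (\<forall>\<phi>. valid_at P \<phi> \<longleftrightarrow> valid_at (q P) \<phi>)" by metis
  have L: "Log C = Log (q ` C)" using q by (auto simp: Log_def)
  show "tabular (Log C)"
    unfolding tabular_def using assms(1) q L by (intro exI[of _ "q ` C"]) auto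
  show "quasi_normal (Log C)"
    unfolding L by (rule quasi_normal_Log) (use q in auto)
qed

end

theory Submission
  imports Defs
begin

text \<open>Interpolation fails exactly when two models on frames of the class agree on all formulas over
  the shared atoms \<open>\<sigma>\<close> and yet cannot be amalgamated into one model of the class.

  Given isomorphic \<open>\<sigma>\<close>-reducts, an amalgam is obtained by transporting the remaining atoms along
  the isomorphism; so under (2) the disjunction of the \<open>\<sigma>\<close>-types of the models of \<open>\<phi>\<close> interpolates
  \<open>\<phi> \<rightarrow> \<psi>\<close>. Conversely, describe \<open>\<sigma>\<close>-bisimilar models \<open>M\<close> and \<open>N\<close> by diagrams that name their worlds
  with disjoint sets of fresh atoms. A model on \<open>F k\<close> of both diagrams is mapped p-morphically onto
  both frames; reducedness forces \<open>i = k = j\<close>, and by finiteness both maps are automorphisms,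
  whose composition is an isomorphism of the \<open>\<sigma>\<close>-reducts. If there is none, then the diagram of \<open>M\<close>
  implies the negated diagram of \<open>N\<close> in \<open>L\<close>, and an interpolant would distinguish \<open>M\<close> from \<open>N\<close>.\<close>

section \<open>Finite conjunctions and iterated boxes\<close>

text \<open>A finite set has no canonical order, so an arbitrary enumeration is conjoined; neither
  truth nor signature depends on the choice. On an infinite set the list is unspecified, hence the
  finiteness premises below.\<close>

definition Conj :: "fm set \<Rightarrow> fm" where
  "Conj X = foldr And (SOME xs. set xs = X) Top"

definition Disj :: "fm set \<Rightarrow> fm" where
  "Disj X = Neg (Conj (Neg ` X))"

lemma set_some_list: "finite X \<Longrightarrow> set (SOME xs. set xs = X) = X"
  using someI_ex[OF finite_list] .

lemma sat_Conj: "finite X \<Longrightarrow> sat M w (Conj X) \<longleftrightarrow> (\<forall>\<phi>\<in>X. sat M w \<phi>)"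
proof -
  have "sat M w (foldr And xs Top) \<longleftrightarrow> (\<forall>\<phi>\<in>set xs. sat M w \<phi>)" for xs
    by (induction xs) auto
  then show "finite X \<Longrightarrow> ?thesis" by (simp add: Conj_def set_some_list)
qed

lemma sig_Conj: "finite X \<Longrightarrow> sig (Conj X) = (\<Union>\<phi>\<in>X. sig \<phi>)"
proof -
  have "sig (foldr And xs Top) = (\<Union>\<phi>\<in>set xs. sig \<phi>)" for xs
    by (induction xs) auto
  then show "finite X \<Longrightarrow> ?thesis" by (simp add: Conj_def set_some_list)
qed

lemma sat_Disj: "finite X \<Longrightarrow> sat M w (Disj X) \<longleftrightarrow> (\<exists>\<phi>\<in>X. sat M w \<phi>)"
  by (simp add: Disj_def sat_Conj)

lemma sig_Disj: "finite X \<Longrightarrow> sig (Disj X) = (\<Union>\<phi>\<in>X. sig \<phi>)"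
  by (simp add: Disj_def sig_Conj)

lemma sat_Box_power:
  "sat M w ((Box ^^ n) \<phi>) \<longleftrightarrow> (\<forall>v. (w, v) \<in> rel (fst M) ^^ n \<longrightarrow> sat M v \<phi>)"
proof (induction n arbitrary: w)
  case (Suc n)
  \<comment> \<open>\<open>relpow\<close> splits off the last step of a path, whereas the outermost
    \<open>Box\<close> speaks of the first.\<close>
  have "(w, v) \<in> rel (fst M) ^^ Suc n \<longleftrightarrow>
      (\<exists>u. (w, u) \<in> rel (fst M) \<and> (u, v) \<in> rel (fst M) ^^ n)" for v
    by (blast intro: relpow_Suc_I2 elim: relpow_Suc_E2)
  with Suc show ?case by (auto simp del: relpow.simps)
qed simp

lemma sig_Box_power: "sig ((Box ^^ n) \<phi>) = sig \<phi>"
  by (induction n) auto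

section \<open>Bisimulations\<close>

lemma bisimulationD:
  assumes "bisimulation \<sigma> M N Z" "(w, v) \<in> Z"
  shows "v \<in> worlds (fst N)"
    and "p \<in> \<sigma> \<Longrightarrow> w \<in> snd M p \<longleftrightarrow> v \<in> snd N p"
    and "(w, w') \<in> rel (fst M) \<Longrightarrow> \<exists>v'. (v, v') \<in> rel (fst N) \<and> (w', v') \<in> Z"
    and "(v, v') \<in> rel (fst N) \<Longrightarrow> \<exists>w'. (w, w') \<in> rel (fst M) \<and> (w', v') \<in> Z"
  using assms unfolding bisimulation_def by (fast+)

lemma bisimulation_sat:
  assumes "bisimulation \<sigma> M N Z" "(w, v) \<in> Z" "sig \<phi> \<subseteq> \<sigma>"
  shows "sat M w \<phi> \<longleftrightarrow> sat N v \<phi>"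
  using assms(2,3)
proof (induction \<phi> arbitrary: w v)
  case (Atom p)
  then show ?case using bisimulationD(2)[OF assms(1)] by simp
next
  case (Box \<phi>)
  then show ?case
    using bisimulationD(3,4)[OF assms(1) Box.prems(1)] by (metis sat.simps(5) sig.simps(5))
qed auto

lemma bisimilar_sat:
  assumes "bisimilar \<sigma> (M, w) (N, v)" "sig \<phi> \<subseteq> \<sigma>"
  shows "sat M w \<phi> \<longleftrightarrow> sat N v \<phi>"
  using assms bisimulation_sat by (fastforce simp: bisimilar_def)

lemma sat_cong:
  assumes "\<And>p. p \<in> sig \<phi> \<Longrightarrow> V p = V' p"
  shows "sat (F, V) w \<phi> \<longleftrightarrow> sat (F, V') w \<phi>"
  using assms by (induction \<phi> arbitrary: w) auto

section \<open>Hennessy-Milner property of finite frames\<close>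

lemma successor_equivalent:
  assumes fin: "finite (rel (fst N) `` {v})"
    and eq: "\<And>\<phi>. sig \<phi> \<subseteq> \<sigma> \<Longrightarrow> sat M w \<phi> \<longleftrightarrow> sat N v \<phi>"
    and w': "(w, w') \<in> rel (fst M)"
  shows "\<exists>v'. (v, v') \<in> rel (fst N) \<and> (\<forall>\<phi>. sig \<phi> \<subseteq> \<sigma> \<longrightarrow> (sat M w' \<phi> \<longleftrightarrow> sat N v' \<phi>))"
proof (rule ccontr)
  assume neg: "\<not> ?thesis"
  have "\<exists>\<phi>. sig \<phi> \<subseteq> \<sigma> \<and> sat M w' \<phi> \<and> \<not> sat N v' \<phi>" if v': "v' \<in> rel (fst N) `` {v}" for v'
  proof -
    obtain \<phi> where \<phi>: "sig \<phi> \<subseteq> \<sigma>" "sat M w' \<phi> \<noteq> sat N v' \<phi>" using neg v' by auto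
    show ?thesis
    proof (cases "sat M w' \<phi>")
      case False
      then show ?thesis using \<phi> by (intro exI[of _ "Neg \<phi>"]) simp
    qed (use \<phi> in blast)
  qed
  then obtain \<delta> where \<delta>: "\<And>v'. v' \<in> rel (fst N) `` {v} \<Longrightarrow>
      sig (\<delta> v') \<subseteq> \<sigma> \<and> sat M w' (\<delta> v') \<and> \<not> sat N v' (\<delta> v')"
    by metis
  \<comment> \<open>No successor satisfies all the \<open>\<delta> v'\<close> together: false at
    \<open>w\<close> because of \<open>w'\<close>, true at \<open>v\<close> because each
    \<open>v'\<close> fails its own \<open>\<delta> v'\<close>. If \<open>v\<close> has no
    successor, the conjunction is empty and the formula says that there is none.\<close>
  let ?\<phi> = "Box (Neg (Conj (\<delta> ` (rel (fst N) `` {v}))))"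
  have fin': "finite (\<delta> ` (rel (fst N) `` {v}))" using fin by simp
  have "sig ?\<phi> \<subseteq> \<sigma>" using \<delta> by (simp only: sig.simps sig_Conj[OF fin']) blast
  moreover have "\<not> sat M w ?\<phi>" using \<delta> w' by (auto simp only: sat.simps sat_Conj[OF fin'])
  moreover have "sat N v ?\<phi>" using \<delta> by (auto simp only: sat.simps sat_Conj[OF fin'])
  ultimately show False using eq by blast
qed

lemma finite_frame_successors:
  assumes "finite_frame F"
  shows "finite (rel F `` {x})"
  using assms finite_subset[of "rel F `` {x}" "worlds F"]
  by (auto simp: finite_frame_def is_frame_def)

text \<open>Equivalence for formulas over \<sigma> is itself a \<sigma>-bisimulation: forth and back
  are \<open>successor_equivalent\<close> read in the two directions, since both frames have finite
  successor sets.\<close>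

lemma hennessy_milner:
  assumes "finite_frame (fst M)" "finite_frame (fst N)"
    and "w \<in> worlds (fst M)" "v \<in> worlds (fst N)"
    and eq: "\<And>\<phi>. sig \<phi> \<subseteq> \<sigma> \<Longrightarrow> sat M w \<phi> \<longleftrightarrow> sat N v \<phi>"
  shows "bisimilar \<sigma> (M, w) (N, v)"
proof -
  let ?Z = "{(a, b). a \<in> worlds (fst M) \<and> b \<in> worlds (fst N) \<and>
    (\<forall>\<phi>. sig \<phi> \<subseteq> \<sigma> \<longrightarrow> (sat M a \<phi> \<longleftrightarrow> sat N b \<phi>))}"
  have "bisimulation \<sigma> M N ?Z"
    unfolding bisimulation_def
  proof (intro conjI ballI, goal_cases)
    case (2 z)
    obtain a b where z: "z = (a, b)" by (cases z)
    have ab: "a \<in> worlds (fst M)" "b \<in> worlds (fst N)"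
      "\<And>\<phi>. sig \<phi> \<subseteq> \<sigma> \<Longrightarrow> sat M a \<phi> \<longleftrightarrow> sat N b \<phi>" using 2 z by auto
    have "a \<in> snd M p \<longleftrightarrow> b \<in> snd N p" if "p \<in> \<sigma>" for p
      using ab(3)[of "Atom p"] that by simp
    moreover have "\<exists>b'. (b, b') \<in> rel (fst N) \<and> (a', b') \<in> ?Z" if a': "(a, a') \<in> rel (fst M)" for a'
    proof -
      have "finite (rel (fst N) `` {b})" using finite_frame_successors[OF assms(2)] .
      from successor_equivalent[where \<sigma> = \<sigma>, OF this ab(3) a'] show ?thesis
        using assms(1,2) a' by (auto simp: finite_frame_def is_frame_def)
    qed
    moreover have "\<exists>a'. (a, a') \<in> rel (fst M) \<and> (a', b') \<in> ?Z" if b': "(b, b') \<in> rel (fst N)" for b'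
    proof -
      have "finite (rel (fst M) `` {a})" using finite_frame_successors[OF assms(1)] .
      from successor_equivalent[where \<sigma> = \<sigma>, OF this ab(3)[symmetric] b'] show ?thesis
        using assms(1,2) b' by (auto simp: finite_frame_def is_frame_def)
    qed
    ultimately show ?case unfolding z by blast
  qed auto
  then show ?thesis using assms(3-5) unfolding bisimilar_def by (intro exI[of _ ?Z]) simp
qed

section \<open>p-morphisms as functional bisimulations\<close>

text \<open>The right-hand side is the usual notion of a p-morphism that respects \<sigma>.
  Representing it by its graph makes \<open>bisimulation_sat\<close> available. As successors in a
  frame are worlds, the pairs demanded by forth and back do lie in the graph.\<close>

lemma bisimulation_graph_iff:
  assumes "is_frame (fst M)"
  shows "bisimulation \<sigma> M N ((\<lambda>w. (w, f w)) ` worlds (fst M)) \<longleftrightarrow>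
    (\<forall>w\<in>worlds (fst M). f w \<in> worlds (fst N) \<and> (\<forall>p\<in>\<sigma>. w \<in> snd M p \<longleftrightarrow> f w \<in> snd N p) \<and>
      (\<forall>w'. (w, w') \<in> rel (fst M) \<longrightarrow> (f w, f w') \<in> rel (fst N)) \<and>
      (\<forall>v. (f w, v) \<in> rel (fst N) \<longrightarrow> (\<exists>w'. (w, w') \<in> rel (fst M) \<and> f w' = v)))"
    (is "?l \<longleftrightarrow> ?r")
proof
  have R: "w' \<in> worlds (fst M)" if "(w, w') \<in> rel (fst M)" for w w'
    using assms that by (auto simp: is_frame_def)
  have graph: "(w, v) \<in> (\<lambda>w. (w, f w)) ` worlds (fst M) \<longleftrightarrow> w \<in> worlds (fst M) \<and> v = f w" for w v
    by auto
  show ?r if ?l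
  proof (intro ballI)
    fix w assume "w \<in> worlds (fst M)"
    then have "(w, f w) \<in> (\<lambda>w. (w, f w)) ` worlds (fst M)" by simp
    note D = bisimulationD[OF \<open>?l\<close> this]
    show "f w \<in> worlds (fst N) \<and> (\<forall>p\<in>\<sigma>. w \<in> snd M p \<longleftrightarrow> f w \<in> snd N p) \<and>
      (\<forall>w'. (w, w') \<in> rel (fst M) \<longrightarrow> (f w, f w') \<in> rel (fst N)) \<and>
      (\<forall>v. (f w, v) \<in> rel (fst N) \<longrightarrow> (\<exists>w'. (w, w') \<in> rel (fst M) \<and> f w' = v))"
      using D(1,2) D(3,4)[unfolded graph] by (auto, metis)
  qed
  show ?l if ?r
    unfolding bisimulation_def
  proof (intro conjI ballI)
    fix z assume "z \<in> (\<lambda>w. (w, f w)) ` worlds (fst M)"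
    then obtain w where z: "z = (w, f w)" and w: "w \<in> worlds (fst M)" by blast
    show "case z of (w, v) \<Rightarrow> (\<forall>p\<in>\<sigma>. w \<in> snd M p \<longleftrightarrow> v \<in> snd N p) \<and>
      (\<forall>w'. (w, w') \<in> rel (fst M) \<longrightarrow> (\<exists>v'. (v, v') \<in> rel (fst N) \<and>
        (w', v') \<in> (\<lambda>w. (w, f w)) ` worlds (fst M))) \<and>
      (\<forall>v'. (v, v') \<in> rel (fst N) \<longrightarrow> (\<exists>w'. (w, w') \<in> rel (fst M) \<and>
        (w', v') \<in> (\<lambda>w. (w, f w)) ` worlds (fst M)))"
      unfolding z graph prod.case using bspec[OF \<open>?r\<close> w] R by blast
  qed (use that in blast)
qed

text \<open>Unlike \<open>sat_iso\<close>, this covers isomorphisms that respect only the atoms in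
  \<sigma>.\<close>

lemma frame_iso_imp_graph_bisimulation:
  assumes iso: "frame_iso f (fst M) (fst N)" and fr: "is_frame (fst M)" "is_frame (fst N)"
    and at: "\<And>w p. w \<in> worlds (fst M) \<Longrightarrow> p \<in> \<sigma> \<Longrightarrow> w \<in> snd M p \<longleftrightarrow> f w \<in> snd N p"
  shows "bisimulation \<sigma> M N ((\<lambda>w. (w, f w)) ` worlds (fst M))"
  unfolding bisimulation_graph_iff[OF fr(1)]
proof (intro ballI conjI allI impI)
  have im: "f ` worlds (fst M) = worlds (fst N)"
    using iso by (simp add: frame_iso_def bij_betw_def)
  fix w assume w: "w \<in> worlds (fst M)"
  show "f w \<in> worlds (fst N)" using im w by blast
  show "w \<in> snd M p \<longleftrightarrow> f w \<in> snd N p" if "p \<in> \<sigma>" for p using at w that .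
  show "(f w, f w') \<in> rel (fst N)" if "(w, w') \<in> rel (fst M)" for w'
    using iso fr(1) that w by (auto simp: frame_iso_def is_frame_def)
  show "\<exists>w'. (w, w') \<in> rel (fst M) \<and> f w' = v" if v: "(f w, v) \<in> rel (fst N)" for v
  proof -
    have "v \<in> worlds (fst N)" using fr(2) v by (auto simp: is_frame_def)
    then obtain w' where "w' \<in> worlds (fst M)" "v = f w'" using im by blast
    then show ?thesis using iso v w by (auto simp: frame_iso_def)
  qed
qed

text \<open>The image contains the root and, by the back condition, is closed under
  successors.\<close>

lemma bisimulation_graph_surj:
  assumes fr: "is_frame (fst M)"
    and bis: "bisimulation \<sigma> M N ((\<lambda>w. (w, f w)) ` worlds (fst M))"
    and r: "r \<in> worlds (fst M)" and root: "rooted_at (fst N) (f r)"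
  shows "f ` worlds (fst M) = worlds (fst N)"
proof
  note p = bis[unfolded bisimulation_graph_iff[OF fr]]
  show "f ` worlds (fst M) \<subseteq> worlds (fst N)" using p by blast
  show "worlds (fst N) \<subseteq> f ` worlds (fst M)"
  proof
    fix v assume "v \<in> worlds (fst N)"
    then have "(f r, v) \<in> (rel (fst N))\<^sup>*" using root by (simp add: rooted_at_def)
    then show "v \<in> f ` worlds (fst M)"
    proof induction
      case (step y z)
      then obtain w where w: "w \<in> worlds (fst M)" "y = f w" by blast
      then obtain w' where w': "(w, w') \<in> rel (fst M)" "f w' = z" using p step by blast
      then have "w' \<in> worlds (fst M)" using fr by (auto simp: is_frame_def)
      then show ?case using w' by blast
    qed (use r in simp)
  qed
qed

text \<open>Every valuation on the target can be pulled back along \<open>f\<close>, so a refutation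
  at \<open>f r\<close> yields one at \<open>r\<close>.\<close>

lemma Log_mono_bisimulation_graph:
  assumes fr: "is_frame (fst M)" and r: "r \<in> worlds (fst M)"
    and bis: "bisimulation \<sigma> M N ((\<lambda>w. (w, f w)) ` worlds (fst M))"
  shows "Log {(fst M, r)} \<subseteq> Log {(fst N, f r)}"
proof
  fix \<phi> assume "\<phi> \<in> Log {(fst M, r)}"
  then have val: "valid_at (fst M, r) \<phi>" by (simp add: Log_def)
  have "sat N' (f r) \<phi>" if N': "based_on N' (fst N)" for N'
  proof -
    let ?M = "(fst M, \<lambda>p. {w \<in> worlds (fst M). f w \<in> snd N' p})"
    \<comment> \<open>The frame conditions are inherited from \<open>bis\<close>; the pulled-back
      valuation makes agreement hold for every atom, not just those in \<sigma>.\<close>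
    have "bisimulation UNIV ?M N' ((\<lambda>w. (w, f w)) ` worlds (fst ?M))"
      using bis N' fr by (subst bisimulation_graph_iff)
        (simp_all add: bisimulation_graph_iff[OF fr] based_on_def)
    then have "sat ?M r \<phi> \<longleftrightarrow> sat N' (f r) \<phi>" by (rule bisimulation_sat) (use r in auto)
    then show ?thesis using val by (auto simp: valid_at_def based_on_def)
  qed
  then show "\<phi> \<in> Log {(fst N, f r)}" by (simp add: Log_def valid_at_def)
qed

text \<open>The back condition gives some successor of \<open>w\<close> with image
  \<open>f v\<close>; injectivity identifies it with \<open>v\<close>, so \<open>f\<close> also
  reflects the relation.\<close>

lemma bij_bisimulation_graph_iso:
  assumes fr: "is_frame (fst M)"
    and bis: "bisimulation \<sigma> M N ((\<lambda>w. (w, f w)) ` worlds (fst M))"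
    and bij: "bij_betw f (worlds (fst M)) (worlds (fst N))"
  shows "frame_iso f (fst M) (fst N)"
  unfolding frame_iso_def
proof (intro conjI ballI iffI bij)
  note p = bis[unfolded bisimulation_graph_iff[OF fr]]
  fix w v assume wv: "w \<in> worlds (fst M)" "v \<in> worlds (fst M)"
  show "(f w, f v) \<in> rel (fst N)" if "(w, v) \<in> rel (fst M)" using p wv that by blast
  assume "(f w, f v) \<in> rel (fst N)"
  then obtain w' where w': "(w, w') \<in> rel (fst M)" "f w' = f v" using p wv by blast
  then have "w' \<in> worlds (fst M)" using fr by (auto simp: is_frame_def)
  then have "w' = v" using w' wv bij by (auto simp: bij_betw_def dest: inj_onD)
  then show "(w, v) \<in> rel (fst M)" using w' by simp
qed

text \<open>The isomorphism runs through \<open>K\<close>: the inverse of \<open>f\<close> followed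
  by \<open>g\<close>.\<close>

lemma reducts_isomorphic_common:
  assumes "frame_iso f (fst K) (fst M)" "frame_iso g (fst K) (fst N)"
    and "f r = a" "g r = b" "r \<in> worlds (fst K)"
    and "\<And>w p. w \<in> worlds (fst K) \<Longrightarrow> p \<in> \<sigma> \<Longrightarrow> w \<in> snd K p \<longleftrightarrow> f w \<in> snd M p"
    and "\<And>w p. w \<in> worlds (fst K) \<Longrightarrow> p \<in> \<sigma> \<Longrightarrow> w \<in> snd K p \<longleftrightarrow> g w \<in> snd N p"
  shows "reducts_isomorphic \<sigma> (M, a) (N, b)"
proof -
  let ?h = "inv_into (worlds (fst K)) f"
  have f: "bij_betw f (worlds (fst K)) (worlds (fst M))"
    and g: "bij_betw g (worlds (fst K)) (worlds (fst N))"
    using assms(1,2) by (auto simp: frame_iso_def)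
  have h: "?h w \<in> worlds (fst K)" "f (?h w) = w" if "w \<in> worlds (fst M)" for w
    using f that by (auto simp: bij_betw_def inv_into_into f_inv_into_f)
  have "?h a = r" using f assms(3,5) by (auto simp: bij_betw_def)
  moreover have "frame_iso (g \<circ> ?h) (fst M) (fst N)"
    unfolding frame_iso_def
  proof (intro conjI ballI)
    show "bij_betw (g \<circ> ?h) (worlds (fst M)) (worlds (fst N))"
      using bij_betw_trans[OF bij_betw_inv_into[OF f] g] .
    fix w v assume wv: "w \<in> worlds (fst M)" "v \<in> worlds (fst M)"
    have "(?h w, ?h v) \<in> rel (fst K) \<longleftrightarrow> (w, v) \<in> rel (fst M)"
      using assms(1) h[OF wv(1)] h[OF wv(2)] by (simp add: frame_iso_def)
    moreover have "(?h w, ?h v) \<in> rel (fst K) \<longleftrightarrow> (g (?h w), g (?h v)) \<in> rel (fst N)"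
      using assms(2) h(1)[OF wv(1)] h(1)[OF wv(2)] by (simp add: frame_iso_def)
    ultimately show "(w, v) \<in> rel (fst M) \<longleftrightarrow> ((g \<circ> ?h) w, (g \<circ> ?h) v) \<in> rel (fst N)"
      by simp
  qed
  moreover have "w \<in> snd M p \<longleftrightarrow> (g \<circ> ?h) w \<in> snd N p" if "w \<in> worlds (fst M)" "p \<in> \<sigma>" for w p
    using assms(6,7)[OF h(1) that(2), OF that(1)] h(2)[OF that(1)] by simp
  ultimately show ?thesis
    unfolding reducts_isomorphic_def using assms(4) by (intro exI[of _ "g \<circ> ?h"]) simp
qed

section \<open>Diagrams of finite models\<close>

text \<open>A description of \<open>x\<close> in the style of Jankov and Fine, where
  \<open>c y\<close> is the name of \<open>y\<close>. The last two groups are the back and forth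
  conditions at \<open>x\<close> for the map sending a world to the world it names. At a dead end
  the final disjunction is empty, that is, false.\<close>

definition state_diagram :: "atom set \<Rightarrow> 'w model \<Rightarrow> ('w \<Rightarrow> atom) \<Rightarrow> 'w \<Rightarrow> fm" where
  "state_diagram \<sigma> M c x = Conj (
     {Atom (c x)} \<union> (\<lambda>y. Neg (Atom (c y))) ` (worlds (fst M) - {x}) \<union>
     Atom ` {p\<in>\<sigma>. x \<in> snd M p} \<union> (\<lambda>p. Neg (Atom p)) ` {p\<in>\<sigma>. x \<notin> snd M p} \<union>
     (\<lambda>y. Neg (Box (Neg (Atom (c y))))) ` (rel (fst M) `` {x}) \<union>
     {Box (Disj ((\<lambda>y. Atom (c y)) ` (rel (fst M) `` {x})))})"

text \<open>No single modality reaches all worlds below the root, so the description is imposed at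
  each depth up to \<open>m\<close>; the bound must be large enough for the frame on which the
  formula is evaluated.\<close>

definition diagram :: "atom set \<Rightarrow> 'w model \<Rightarrow> ('w \<Rightarrow> atom) \<Rightarrow> 'w \<Rightarrow> nat \<Rightarrow> fm" where
  "diagram \<sigma> M c r m = And (Atom (c r))
     (Conj ((\<lambda>l. (Box ^^ l) (Disj (state_diagram \<sigma> M c ` worlds (fst M)))) ` {..m}))"

lemma sat_state_diagram:
  assumes "finite \<sigma>" "finite_frame (fst M)"
  shows "sat K w (state_diagram \<sigma> M c x) \<longleftrightarrow>
    w \<in> snd K (c x) \<and> (\<forall>y\<in>worlds (fst M) - {x}. w \<notin> snd K (c y)) \<and>
    (\<forall>p\<in>\<sigma>. w \<in> snd K p \<longleftrightarrow> x \<in> snd M p) \<and>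
    (\<forall>y. (x, y) \<in> rel (fst M) \<longrightarrow> (\<exists>v. (w, v) \<in> rel (fst K) \<and> v \<in> snd K (c y))) \<and>
    (\<forall>v. (w, v) \<in> rel (fst K) \<longrightarrow> (\<exists>y. (x, y) \<in> rel (fst M) \<and> v \<in> snd K (c y)))"
proof -
  have "finite (worlds (fst M))" using assms by (simp add: finite_frame_def)
  then show ?thesis
    unfolding state_diagram_def using assms finite_frame_successors[OF assms(2), of x]
    by (subst sat_Conj) (simp, simp add: ball_Un sat_Disj, blast)
qed

lemma sig_state_diagram:
  assumes "finite \<sigma>" "finite_frame (fst M)" "x \<in> worlds (fst M)"
  shows "sig (state_diagram \<sigma> M c x) \<subseteq> \<sigma> \<union> c ` worlds (fst M)"
proof -
  have "finite (worlds (fst M))" "rel (fst M) `` {x} \<subseteq> worlds (fst M)"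
    using assms by (auto simp: finite_frame_def is_frame_def)
  then show ?thesis
    unfolding state_diagram_def using assms finite_frame_successors[OF assms(2), of x]
    by (subst sig_Conj) (simp, auto simp: sig_Disj)
qed

lemma sat_diagram:
  assumes "finite \<sigma>" "finite_frame (fst M)"
  shows "sat K w (diagram \<sigma> M c r m) \<longleftrightarrow> w \<in> snd K (c r) \<and>
    (\<forall>l\<le>m. \<forall>v. (w, v) \<in> rel (fst K) ^^ l \<longrightarrow>
      (\<exists>x\<in>worlds (fst M). sat K v (state_diagram \<sigma> M c x)))"
  using assms by (auto simp: diagram_def sat_Conj sat_Box_power sat_Disj finite_frame_def)

lemma sig_diagram:
  assumes "finite \<sigma>" "finite_frame (fst M)" "r \<in> worlds (fst M)"
  shows "sig (diagram \<sigma> M c r m) \<subseteq> \<sigma> \<union> c ` worlds (fst M)"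
  using assms sig_state_diagram[OF assms(1,2)]
  by (auto simp: diagram_def sig_Conj sig_Box_power sig_Disj finite_frame_def)

lemma sat_own_diagram:
  assumes \<sigma>: "finite \<sigma>" and fr: "finite_frame (fst M)" and r: "r \<in> worlds (fst M)"
    and inj: "inj_on c (worlds (fst M))" and K: "fst K = fst M"
    and atoms: "\<And>p. p \<in> \<sigma> \<Longrightarrow> snd K p = snd M p"
    and names: "\<And>x. x \<in> worlds (fst M) \<Longrightarrow> snd K (c x) = {x}"
  shows "sat K r (diagram \<sigma> M c r m)"
proof -
  have R: "v \<in> worlds (fst M)" if "(w, v) \<in> rel (fst M)" for w v
    using fr that by (auto simp: finite_frame_def is_frame_def)
  have "sat K v (state_diagram \<sigma> M c v)" if "v \<in> worlds (fst M)" for v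
    unfolding sat_state_diagram[OF \<sigma> fr] using that K atoms names R by auto
  moreover have "v \<in> worlds (fst M)" if "(r, v) \<in> rel (fst M) ^^ l" for v l
    using that r R by (cases l) auto
  ultimately show ?thesis
    unfolding sat_diagram[OF \<sigma> fr] using K names r by auto
qed

text \<open>Each world of \<open>K\<close> satisfies the description of some world of
  \<open>M\<close>, and mapping it there is a p-morphism because the descriptions contain the back
  and forth conditions.\<close>

lemma diagram_bisimulation_graph:
  assumes \<sigma>: "finite \<sigma>" and fr: "finite_frame (fst M)" and frK: "finite_frame (fst K)"
    and r: "r \<in> worlds (fst M)" and root: "rooted_at (fst K) k"
    and m: "card (rel (fst K)) \<le> m" and sat: "sat K k (diagram \<sigma> M c r m)"
  shows "\<exists>f. bisimulation \<sigma> K M ((\<lambda>w. (w, f w)) ` worlds (fst K)) \<and> f k = r"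
proof -
  let ?S = "\<lambda>w x. sat K w (state_diagram \<sigma> M c x)"
  note S = sat_state_diagram[OF \<sigma> fr]
  have RK: "v \<in> worlds (fst K)" if "(w, v) \<in> rel (fst K)" for w v
    using frK that by (auto simp: finite_frame_def is_frame_def)
  have R: "v \<in> worlds (fst M)" if "(w, v) \<in> rel (fst M)" for w v
    using fr that by (auto simp: finite_frame_def is_frame_def)
  have "finite (rel (fst K))"
    using frK finite_subset[of "rel (fst K)" "worlds (fst K) \<times> worlds (fst K)"]
    by (auto simp: finite_frame_def is_frame_def)
  \<comment> \<open>A reachable world is reachable in at most as many steps as the relation has
    pairs, so depth \<open>m\<close> covers all of \<open>K\<close>.\<close>
  note reach = rtrancl_finite_eq_relpow[OF this]
  have "\<exists>l\<le>m. (k, w) \<in> rel (fst K) ^^ l" if "w \<in> worlds (fst K)" for w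
  proof -
    have "(k, w) \<in> (rel (fst K))\<^sup>*" using root that by (simp add: rooted_at_def)
    then obtain l where "l \<le> card (rel (fst K))" "(k, w) \<in> rel (fst K) ^^ l"
      unfolding reach by auto
    then show ?thesis using m le_trans by blast
  qed
  then have "\<exists>x\<in>worlds (fst M). ?S w x" if "w \<in> worlds (fst K)" for w
    using sat that unfolding sat_diagram[OF \<sigma> fr] by blast
  then obtain f where f: "\<And>w. w \<in> worlds (fst K) \<Longrightarrow> f w \<in> worlds (fst M) \<and> ?S w (f w)"
    by metis
  \<comment> \<open>A description excludes all other names, so carrying the name of \<open>x\<close>
    determines the value of \<open>f\<close>. This turns statements about names of successors into
    statements about \<open>f\<close>.\<close>
  have uniq: "f w = x" if "w \<in> worlds (fst K)" "x \<in> worlds (fst M)" "w \<in> snd K (c x)" for w x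
    using f that unfolding S by blast
  have "bisimulation \<sigma> K M ((\<lambda>w. (w, f w)) ` worlds (fst K))"
  proof (subst bisimulation_graph_iff, goal_cases)
    case 2
    show ?case
    proof (intro ballI conjI allI impI)
      fix w assume w: "w \<in> worlds (fst K)"
      note fw = f[OF w, unfolded S]
      show "f w \<in> worlds (fst M)" using fw by blast
      show "w \<in> snd K p \<longleftrightarrow> f w \<in> snd M p" if "p \<in> \<sigma>" for p using fw that by blast
      show "(f w, f w') \<in> rel (fst M)" if "(w, w') \<in> rel (fst K)" for w'
        using fw that R RK uniq by metis
      show "\<exists>w'. (w, w') \<in> rel (fst K) \<and> f w' = v" if "(f w, v) \<in> rel (fst M)" for v
        using fw that R RK uniq by metis
    qed
  qed (use frK in \<open>simp add: finite_frame_def\<close>)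
  moreover have "f k = r"
    using uniq root r sat unfolding rooted_at_def sat_diagram[OF \<sigma> fr] by blast
  ultimately show ?thesis by blast
qed

lemma fresh_names:
  assumes "finite W" "finite A"
  shows "\<exists>c :: 'w \<Rightarrow> atom. inj_on c W \<and> c ` W \<inter> A = {}"
proof -
  obtain b where b: "\<And>a. a \<in> A \<Longrightarrow> a < b"
    using finite_nat_set_iff_bounded[of A] assms(2) by blast
  obtain g :: "'w \<Rightarrow> nat" where g: "inj_on g W" using finite_imp_inj_to_nat_seg[OF assms(1)] by blast
  show ?thesis using b g by (intro exI[of _ "\<lambda>w. b + g w"]) (auto simp: inj_on_def dest: b)
qed

lemma named_model:
  assumes fr: "finite_frame (fst M)" and M: "based_on M (fst M)" and \<sigma>: "finite \<sigma>"
    and r: "r \<in> worlds (fst M)"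
    and inj: "inj_on c (worlds (fst M))" and fresh: "c ` worlds (fst M) \<inter> \<sigma> = {}"
  shows "\<exists>K. based_on K (fst M) \<and> (\<forall>p\<in>\<sigma>. snd K p = snd M p) \<and> sat K r (diagram \<sigma> M c r m)"
proof -
  \<comment> \<open>Outside \<sigma> an atom holds exactly at the world it names, and nowhere if it
    names none. Freshness keeps the names out of the first branch.\<close>
  let ?K = "(fst M, \<lambda>p. if p \<in> \<sigma> then snd M p else {x \<in> worlds (fst M). c x = p})"
  have "sat ?K r (diagram \<sigma> M c r m)"
    by (rule sat_own_diagram[OF \<sigma> fr r inj])
      (use fresh inj in \<open>auto simp: inj_on_def\<close>)
  moreover have "based_on ?K (fst M)" using M by (auto simp: based_on_def)
  ultimately show ?thesis by (intro exI[of _ ?K]) simp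
qed

section \<open>The equivalence\<close>

lemma Imp_in_Log_iff:
  "Imp \<phi> \<psi> \<in> Log ((\<lambda>i. (F i, r i)) ` I) \<longleftrightarrow>
    (\<forall>i\<in>I. \<forall>M. based_on M (F i) \<longrightarrow> sat M (r i) \<phi> \<longrightarrow> sat M (r i) \<psi>)"
  by (auto simp: Log_def valid_at_def simp del: split_paired_All)

text \<open>Isomorphic pointed frames have the same logic, which reducedness forbids for distinct
  indices.\<close>

lemma reduced_frame_iso_eq:
  assumes "reduced I (\<lambda>i. (F i, r i))" "i \<in> I" "j \<in> I"
    and "\<And>i. i \<in> I \<Longrightarrow> is_frame (F i)" "\<And>i. i \<in> I \<Longrightarrow> r i \<in> worlds (F i)"
    and "frame_iso f (F i) (F j)" "f (r i) = r j"
  shows "i = j"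
proof -
  have "Log {(F i, r i)} = Log {(F j, r j)}"
    using valid_at_iso[OF assms(6), of "r i"] assms by (auto simp: Log_def)
  then show ?thesis using assms(1-3) by (auto simp: reduced_def)
qed

section \<open>From interpolation to isomorphic reducts\<close>

lemma craig_imp_reducts_isomorphic:
  assumes I: "finite I" and fin: "\<And>i. i \<in> I \<Longrightarrow> finite_frame (F i)"
    and root: "\<And>i. i \<in> I \<Longrightarrow> rooted_at (F i) (r i)"
    and red: "reduced I (\<lambda>i. (F i, r i))"
    and craig: "craig_interpolation (Log ((\<lambda>i. (F i, r i)) ` I))" (is "craig_interpolation ?L")
    and \<sigma>: "finite \<sigma>" and ij: "i \<in> I" "j \<in> I"
    and M: "based_on M (F i)" and N: "based_on N (F j)"
    and bis: "bisimilar \<sigma> (M, r i) (N, r j)"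
  shows "reducts_isomorphic \<sigma> (M, r i) (N, r j)"
proof (rule ccontr)
  assume neg: "\<not> ?thesis"
  have FM: "fst M = F i" and FN: "fst N = F j" using M N by (auto simp: based_on_def)
  have ri: "r k \<in> worlds (F k)" if "k \<in> I" for k using root[OF that] by (simp add: rooted_at_def)
  have isf: "is_frame (F k)" "finite (worlds (F k))" if "k \<in> I" for k
    using fin[OF that] by (auto simp: finite_frame_def)
  \<comment> \<open>The diagrams are fixed before it is known which \<open>F k\<close> carries a
    common model, so one depth must serve all frames.\<close>
  define m where "m = (\<Sum>k\<in>I. card (rel (F k)))"
  have m: "card (rel (F k)) \<le> m" if "k \<in> I" for k
    unfolding m_def by (rule member_le_sum) (use that I in auto)
  obtain c where c: "inj_on c (worlds (F i))" "c ` worlds (F i) \<inter> \<sigma> = {}"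
    using fresh_names[OF isf(2)[OF ij(1)] \<sigma>] by blast
  \<comment> \<open>Avoiding the names \<open>c\<close> as well leaves only atoms of \<sigma> common
    to both diagrams.\<close>
  obtain d where d: "inj_on d (worlds (F j))" "d ` worlds (F j) \<inter> (\<sigma> \<union> c ` worlds (F i)) = {}"
    using fresh_names[OF isf(2)[OF ij(2)], of "\<sigma> \<union> c ` worlds (F i)"] \<sigma> isf(2)[OF ij(1)] by blast
  let ?\<phi> = "diagram \<sigma> M c (r i) m" and ?\<psi> = "diagram \<sigma> N d (r j) m"
  have iso: "k = l \<and> (\<exists>f. frame_iso f (F k) (F l) \<and> f (r k) = r l \<and>
      (\<forall>w\<in>worlds (F k). \<forall>p\<in>\<sigma>. w \<in> snd K p \<longleftrightarrow> f w \<in> snd A p))"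
    if k: "k \<in> I" and l: "l \<in> I" and K: "fst K = F k" and A: "fst A = F l"
      and s: "sat K (r k) (diagram \<sigma> A e (r l) m)" for k l K A e
  proof -
    obtain f where f: "bisimulation \<sigma> K A ((\<lambda>w. (w, f w)) ` worlds (fst K))" "f (r k) = r l"
      using diagram_bisimulation_graph[OF \<sigma> _ _ _ _ _ s] fin root ri m k l K A by auto
    have fK: "is_frame (fst K)" using isf k K by simp
    have "Log {(F k, r k)} \<subseteq> Log {(F l, r l)}"
      using Log_mono_bisimulation_graph[OF fK _ f(1)] ri[OF k] K A f(2) by metis
    then have kl: "k = l" using red k l by (auto simp: reduced_def)
    have "f ` worlds (F k) = worlds (F l)"
      using bisimulation_graph_surj[OF fK f(1)] ri[OF k] root[OF l] K A f(2) by simp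
    \<comment> \<open>With \<open>k = l\<close>, the map is a surjection of a finite set onto
      itself, hence injective.\<close>
    then have "bij_betw f (worlds (F k)) (worlds (F l))"
      using kl isf(2)[OF k] by (simp add: bij_betw_def finite_surj_inj)
    then have "frame_iso f (F k) (F l)"
      using bij_bisimulation_graph_iso[OF fK f(1)] K A by simp
    moreover have "\<forall>w\<in>worlds (F k). \<forall>p\<in>\<sigma>. w \<in> snd K p \<longleftrightarrow> f w \<in> snd A p"
      using f(1)[unfolded bisimulation_graph_iff[OF fK]] K by (simp add: ball_conj_distrib)
    ultimately show ?thesis using kl f(2) by blast
  qed
  have "Imp ?\<phi> (Neg ?\<psi>) \<in> ?L"
  proof -
    have False if k: "k \<in> I" and K: "based_on K (F k)"
      and s: "sat K (r k) ?\<phi>" "sat K (r k) ?\<psi>" for k K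
    proof -
      have FK: "fst K = F k" using K by (simp add: based_on_def)
      obtain f where f: "frame_iso f (F k) (F i)" "f (r k) = r i"
        "\<And>w p. w \<in> worlds (F k) \<Longrightarrow> p \<in> \<sigma> \<Longrightarrow> w \<in> snd K p \<longleftrightarrow> f w \<in> snd M p"
        using iso[OF k ij(1) FK FM s(1)] by blast
      obtain g where g: "frame_iso g (F k) (F j)" "g (r k) = r j"
        "\<And>w p. w \<in> worlds (F k) \<Longrightarrow> p \<in> \<sigma> \<Longrightarrow> w \<in> snd K p \<longleftrightarrow> g w \<in> snd N p"
        using iso[OF k ij(2) FK FN s(2)] by blast
      have "reducts_isomorphic \<sigma> (M, r i) (N, r j)"
        by (rule reducts_isomorphic_common[of f K M g N "r k"])
          (use f g FK FM FN ri[OF k] in simp_all)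
      then show False using neg by blast
    qed
    then show ?thesis unfolding Imp_in_Log_iff sat.simps by blast
  qed
  then obtain \<chi> where \<chi>: "Imp ?\<phi> \<chi> \<in> ?L" "Imp \<chi> (Neg ?\<psi>) \<in> ?L" "sig \<chi> \<subseteq> sig ?\<phi> \<inter> sig (Neg ?\<psi>)"
    using craig unfolding craig_interpolation_def by meson
  have "sig ?\<phi> \<subseteq> \<sigma> \<union> c ` worlds (F i)" "sig ?\<psi> \<subseteq> \<sigma> \<union> d ` worlds (F j)"
    using sig_diagram[OF \<sigma>] fin ri ij FM FN by metis+
  then have "sig \<chi> \<subseteq> (\<sigma> \<union> c ` worlds (F i)) \<inter> (\<sigma> \<union> d ` worlds (F j))" using \<chi>(3) by auto
  then have sig\<chi>: "sig \<chi> \<subseteq> \<sigma>" using d(2) by blast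
  obtain K where K: "based_on K (F i)" "\<forall>p\<in>\<sigma>. snd K p = snd M p" "sat K (r i) ?\<phi>"
    using named_model[of M \<sigma> "r i" c m] fin ri ij(1) M \<sigma> c FM by auto
  have "d ` worlds (F j) \<inter> \<sigma> = {}" using d(2) by blast
  then obtain K' where K': "based_on K' (F j)" "\<forall>p\<in>\<sigma>. snd K' p = snd N p" "sat K' (r j) ?\<psi>"
    using named_model[of N \<sigma> "r j" d m] fin ri ij(2) N \<sigma> d(1) FN by auto
  \<comment> \<open>Truth of \<chi> now travels from \<open>K\<close> to \<open>M\<close>, by
    bisimilarity to \<open>N\<close>, and on to \<open>K'\<close>. The outer two moves change only
    atoms outside \<sigma>. At \<open>K'\<close> the second diagram holds, contradicting the other
    half of interpolation.\<close>
  have "sat K (r i) \<chi>"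
    using \<chi>(1)[unfolded Imp_in_Log_iff] K(1,3) ij(1) by blast
  then have "sat M (r i) \<chi>"
    using sat_cong[of \<chi> "snd K" "snd M" "F i"] K(1,2) FM sig\<chi>
    by (metis based_on_def prod.collapse subsetD)
  then have "sat N (r j) \<chi>" using bisimilar_sat[OF bis sig\<chi>] by blast
  then have "sat K' (r j) \<chi>"
    using sat_cong[of \<chi> "snd K'" "snd N" "F j"] K'(1,2) FN sig\<chi>
    by (metis based_on_def prod.collapse subsetD)
  then show False
    using \<chi>(2)[unfolded Imp_in_Log_iff sat.simps] K'(1,3) ij(2) by blast
qed

section \<open>From isomorphic reducts to interpolation\<close>

lemma amalgamation:
  assumes fr: "is_frame F" "is_frame G"
    and M: "based_on M F" and N: "based_on N G" and r: "r \<in> worlds F"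
    and iso: "reducts_isomorphic (sig \<phi> \<inter> sig \<psi>) (M, r) (N, s)"
  shows "\<exists>K. based_on K F \<and> (sat K r \<phi> \<longleftrightarrow> sat M r \<phi>) \<and> (sat K r \<psi> \<longleftrightarrow> sat N s \<psi>)"
proof -
  have FM: "fst M = F" "\<And>p. snd M p \<subseteq> worlds F" and FN: "fst N = G"
    using M N by (auto simp: based_on_def)
  obtain f where f: "frame_iso f F G" "f r = s"
    "\<And>w p. w \<in> worlds F \<Longrightarrow> p \<in> sig \<phi> \<Longrightarrow> p \<in> sig \<psi> \<Longrightarrow> w \<in> snd M p \<longleftrightarrow> f w \<in> snd N p"
    using iso FM FN unfolding reducts_isomorphic_def by auto
  \<comment> \<open>Atoms of \<phi> are read in \<open>M\<close>, all others are pulled back from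
    \<open>N\<close>. For shared atoms the two readings agree by the isomorphism, so \<psi> sees
    \<open>N\<close>.\<close>
  let ?K = "(F, \<lambda>p. if p \<in> sig \<phi> then snd M p else {w \<in> worlds F. f w \<in> snd N p})"
  have "sat ?K r \<phi> \<longleftrightarrow> sat (F, snd M) r \<phi>" by (rule sat_cong) simp
  then have "sat ?K r \<phi> \<longleftrightarrow> sat M r \<phi>" using FM(1) by (cases M) simp
  moreover have "bisimulation (sig \<psi>) ?K N ((\<lambda>w. (w, f w)) ` worlds (fst ?K))"
    by (rule frame_iso_imp_graph_bisimulation) (use f FN fr in auto)
  then have "sat ?K r \<psi> \<longleftrightarrow> sat N s \<psi>"
    by (rule bisimulation_sat) (use r f(2) in auto)
  moreover have "based_on ?K F" using FM(2) by (auto simp: based_on_def)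
  ultimately show ?thesis by blast
qed

text \<open>With infinitely many atoms a frame carries infinitely many models; emptying the atoms
  outside \<sigma> leaves finitely many, so that types and their disjunction are formulas.\<close>

lemma finite_models_of_signature:
  assumes "finite \<sigma>" "finite (worlds F)"
  shows "finite {M. based_on M F \<and> (\<forall>p. p \<notin> \<sigma> \<longrightarrow> snd M p = {})}"
proof (rule finite_subset)
  show "finite (Pair F ` {V. \<forall>p. (p \<in> \<sigma> \<longrightarrow> V p \<in> Pow (worlds F)) \<and> (p \<notin> \<sigma> \<longrightarrow> V p = {})})"
    using finite_set_of_finite_funs[OF assms(1), of "Pow (worlds F)" "{}"] assms(2) by simp
  show "{M. based_on M F \<and> (\<forall>p. p \<notin> \<sigma> \<longrightarrow> snd M p = {})} \<subseteq> \<dots>"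
  proof
    fix M assume "M \<in> {M. based_on M F \<and> (\<forall>p. p \<notin> \<sigma> \<longrightarrow> snd M p = {})}"
    then show "M \<in> Pair F ` {V. \<forall>p. (p \<in> \<sigma> \<longrightarrow> V p \<in> Pow (worlds F)) \<and> (p \<notin> \<sigma> \<longrightarrow> V p = {})}"
      by (intro image_eqI[of _ _ "snd M"]) (auto simp: based_on_def)
  qed
qed

lemma reducts_isomorphic_imp_craig:
  fixes F :: "'i \<Rightarrow> 'w frame"
  assumes I: "finite I" and fin: "\<And>i. i \<in> I \<Longrightarrow> finite_frame (F i)"
    and r: "\<And>i. i \<in> I \<Longrightarrow> r i \<in> worlds (F i)"
    and iso: "\<And>\<sigma> i j M N. finite \<sigma> \<Longrightarrow> i \<in> I \<Longrightarrow> j \<in> I \<Longrightarrow> based_on M (F i) \<Longrightarrow>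
      based_on N (F j) \<Longrightarrow> bisimilar \<sigma> (M, r i) (N, r j) \<Longrightarrow> reducts_isomorphic \<sigma> (M, r i) (N, r j)"
  shows "craig_interpolation (Log ((\<lambda>i. (F i, r i)) ` I))" (is "craig_interpolation ?L")
  unfolding craig_interpolation_def
proof (intro allI impI)
  fix \<phi> \<psi> assume imp: "Imp \<phi> \<psi> \<in> ?L"
  define \<sigma> where "\<sigma> = sig \<phi> \<inter> sig \<psi>"
  have "finite (sig \<phi>)" by (induction \<phi>) auto
  then have \<sigma>: "finite \<sigma>" by (simp add: \<sigma>_def)
  define red :: "'w model \<Rightarrow> 'w model"
    where "red M = (fst M, \<lambda>p. if p \<in> \<sigma> then snd M p else {})" for M
  define A :: "('w model \<times> 'w) set"
    where "A = (\<Union>i\<in>I. (\<lambda>M. (M, r i)) ` {M. based_on M (F i) \<and> (\<forall>p. p \<notin> \<sigma> \<longrightarrow> snd M p = {})})"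
  \<comment> \<open>Truth of \<phi> is tested in \<open>M\<close> before reduction, as \<phi> may
    contain atoms outside \<sigma>.\<close>
  define B where "B = {(red M, r i) |M i. i \<in> I \<and> based_on M (F i) \<and> sat M (r i) \<phi>}"
  have finA: "finite A"
    unfolding A_def using I finite_models_of_signature[OF \<sigma>] fin
    by (auto simp: finite_frame_def)
  have redA: "(red M, r i) \<in> A" if "i \<in> I" "based_on M (F i)" for M i
    unfolding A_def
    by (rule UN_I[OF that(1)], rule imageI) (use that(2) in \<open>auto simp: red_def based_on_def\<close>)
  have BA: "B \<subseteq> A" unfolding B_def using redA by blast
  then have finB: "finite B" using finA finite_subset by blast
  have sat_red: "sat (red M) w \<chi> \<longleftrightarrow> sat M w \<chi>" if "sig \<chi> \<subseteq> \<sigma>" for M w \<chi>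
    using sat_cong[of \<chi> "snd (red M)" "snd M" "fst M" w] that by (auto simp: red_def subset_iff)
  have "\<exists>\<delta>. sig \<delta> \<subseteq> \<sigma> \<and> sat (fst P) (snd P) \<delta> \<and> \<not> sat (fst Q) (snd Q) \<delta>"
    if PQ: "P \<in> A" "Q \<in> A" "\<not> bisimilar \<sigma> P Q" for P Q
  proof -
    have "finite_frame (fst (fst X)) \<and> snd X \<in> worlds (fst (fst X))" if "X \<in> A" for X
      using that fin r by (auto simp: A_def based_on_def)
    then obtain \<delta> where \<delta>: "sig \<delta> \<subseteq> \<sigma>" "sat (fst P) (snd P) \<delta> \<noteq> sat (fst Q) (snd Q) \<delta>"
      using hennessy_milner[of "fst P" "fst Q" "snd P" "snd Q" \<sigma>] PQ by auto
    show ?thesis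
    proof (cases "sat (fst P) (snd P) \<delta>")
      case False
      then show ?thesis using \<delta> by (intro exI[of _ "Neg \<delta>"]) simp
    qed (use \<delta> in blast)
  qed
  then obtain \<delta> where \<delta>: "\<And>P Q. P \<in> A \<Longrightarrow> Q \<in> A \<Longrightarrow> \<not> bisimilar \<sigma> P Q \<Longrightarrow>
      sig (\<delta> P Q) \<subseteq> \<sigma> \<and> sat (fst P) (snd P) (\<delta> P Q) \<and> \<not> sat (fst Q) (snd Q) (\<delta> P Q)"
    by metis
  \<comment> \<open>Within \<open>A\<close>, this formula isolates the bisimilarity class of
    \<open>P\<close>: it holds at \<open>P\<close> and fails at every member of \<open>A\<close> not
    bisimilar to \<open>P\<close>.\<close>
  define type where "type P = Conj (\<delta> P ` {Q \<in> A. \<not> bisimilar \<sigma> P Q})" for P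
  have fin_type: "finite (\<delta> P ` {Q \<in> A. \<not> bisimilar \<sigma> P Q})" for P using finA by simp
  define \<chi> where "\<chi> = Disj (type ` B)"
  have sig\<chi>: "sig \<chi> \<subseteq> \<sigma>"
    using \<delta> BA finB unfolding \<chi>_def type_def
    by (simp add: sig_Disj sig_Conj[OF fin_type]) blast
  have "Imp \<phi> \<chi> \<in> ?L"
  proof -
    have "sat M (r i) \<chi>" if "i \<in> I" "based_on M (F i)" "sat M (r i) \<phi>" for i M
    proof -
      have B: "(red M, r i) \<in> B" unfolding B_def using that by blast
      then have "sat (red M) (r i) (type (red M, r i))"
        using \<delta>[of "(red M, r i)"] BA unfolding type_def sat_Conj[OF fin_type] by auto
      then have "sat (red M) (r i) \<chi>" using B finB by (auto simp: \<chi>_def sat_Disj)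
      then show ?thesis using sat_red[OF sig\<chi>] by blast
    qed
    then show ?thesis unfolding Imp_in_Log_iff sat.simps by blast
  qed
  moreover have "Imp \<chi> \<psi> \<in> ?L"
  proof -
    have "sat N (r j) \<psi>" if j: "j \<in> I" and N: "based_on N (F j)" and s: "sat N (r j) \<chi>" for j N
    proof -
      have "sat (red N) (r j) \<chi>" using s sat_red[OF sig\<chi>] by blast
      then obtain M i where i: "i \<in> I" and M: "based_on M (F i)" "sat M (r i) \<phi>"
        and t: "sat (red N) (r j) (type (red M, r i))"
        using finB unfolding \<chi>_def B_def by (auto simp: sat_Disj simp del: split_paired_Ex)
      have MN: "(red M, r i) \<in> A" "(red N, r j) \<in> A" using redA[OF i M(1)] redA[OF j N] .
      have "bisimilar \<sigma> (red M, r i) (red N, r j)"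
        using \<delta>[OF MN] t MN(2) unfolding type_def sat_Conj[OF fin_type] by auto
      then have "reducts_isomorphic \<sigma> (red M, r i) (red N, r j)"
        using iso[OF \<sigma> i j] M(1) N by (auto simp: red_def based_on_def)
      \<comment> \<open>\<open>red\<close> changes neither frames nor atoms of \<sigma>, so the
        isomorphism also serves the original models, which still interpret all of \<phi> and
        \<psi>.\<close>
      then have "reducts_isomorphic \<sigma> (M, r i) (N, r j)"
        by (simp add: reducts_isomorphic_def red_def)
      \<comment> \<open>The amalgam \<open>K\<close> satisfies \<phi>, hence \<psi> because the
        implication is in the logic, and it agrees with \<open>N\<close> on \<psi>.\<close>
      then obtain K where "based_on K (F i)" "sat K (r i) \<phi>" "sat K (r i) \<psi> \<longleftrightarrow> sat N (r j) \<psi>"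
        using amalgamation[OF _ _ M(1) N r[OF i]] fin i j M(2)
        unfolding \<sigma>_def finite_frame_def by blast
      then show ?thesis using imp[unfolded Imp_in_Log_iff] i by blast
    qed
    then show ?thesis unfolding Imp_in_Log_iff sat.simps by blast
  qed
  ultimately show "\<exists>\<chi>. Imp \<phi> \<chi> \<in> ?L \<and> Imp \<chi> \<psi> \<in> ?L \<and> sig \<chi> \<subseteq> sig \<phi> \<inter> sig \<psi>"
    using sig\<chi> unfolding \<sigma>_def by blast
qed

text \<open>The second conjunct renders the parenthetical claim \<open>i = j\<close>. It is stated
  for isomorphic reducts, and so applies to whatever condition (2) delivers.\<close>

theorem theorem5p1:
  fixes L :: "fm set"
    and n :: nat
    and F :: "nat \<Rightarrow> 'w frame"
    and r :: "nat \<Rightarrow> 'w"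
  assumes "quasi_normal L" and "tabular L"
    and "L = Log ((\<lambda>i. (F i, r i)) ` {1..n})"
    and "\<And>i. i \<in> {1..n} \<Longrightarrow> finite_frame (F i)"
    and "\<And>i. i \<in> {1..n} \<Longrightarrow> rooted_at (F i) (r i)"
    and "reduced {1..n} (\<lambda>i. (F i, r i))"
  shows "(craig_interpolation L \<longleftrightarrow>
      (\<forall>\<sigma>. finite \<sigma> \<longrightarrow> (\<forall>i \<in> {1..n}. \<forall>j \<in> {1..n}. \<forall>M N.
        based_on M (F i) \<longrightarrow> based_on N (F j) \<longrightarrow>
        bisimilar \<sigma> (M, r i) (N, r j) \<longrightarrow>
        reducts_isomorphic \<sigma> (M, r i) (N, r j))))
    \<and> (\<forall>\<sigma>. finite \<sigma> \<longrightarrow> (\<forall>i \<in> {1..n}. \<forall>j \<in> {1..n}. \<forall>M N.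
        based_on M (F i) \<longrightarrow> based_on N (F j) \<longrightarrow>
        reducts_isomorphic \<sigma> (M, r i) (N, r j) \<longrightarrow> i = j))"
proof (rule conjI)
  have ff: "is_frame (F i)" "r i \<in> worlds (F i)" if "i \<in> {1..n}" for i
    using assms(4,5)[OF that] by (auto simp: finite_frame_def rooted_at_def)
  show "\<forall>\<sigma>. finite \<sigma> \<longrightarrow> (\<forall>i \<in> {1..n}. \<forall>j \<in> {1..n}. \<forall>M N.
        based_on M (F i) \<longrightarrow> based_on N (F j) \<longrightarrow>
        reducts_isomorphic \<sigma> (M, r i) (N, r j) \<longrightarrow> i = j)"
  proof (intro allI ballI impI)
    fix \<sigma> i j M N
    assume ij: "i \<in> {1..n}" "j \<in> {1..n}" and "based_on M (F i)" "based_on N (F j)"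
      "reducts_isomorphic \<sigma> (M, r i) (N, r j)"
    then obtain f where "frame_iso f (F i) (F j)" "f (r i) = r j"
      by (auto simp: reducts_isomorphic_def based_on_def)
    then show "i = j" using reduced_frame_iso_eq[OF assms(6) ij ff] by blast
  qed
  show "craig_interpolation L \<longleftrightarrow>
      (\<forall>\<sigma>. finite \<sigma> \<longrightarrow> (\<forall>i \<in> {1..n}. \<forall>j \<in> {1..n}. \<forall>M N.
        based_on M (F i) \<longrightarrow> based_on N (F j) \<longrightarrow>
        bisimilar \<sigma> (M, r i) (N, r j) \<longrightarrow>
        reducts_isomorphic \<sigma> (M, r i) (N, r j)))" (is "_ \<longleftrightarrow> ?iso")
  proof
    assume "craig_interpolation L"
    then show ?iso
      unfolding assms(3)
      using craig_imp_reducts_isomorphic[OF finite_atLeastAtMost assms(4-6)] by blast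
  next
    assume ?iso
    then show "craig_interpolation L"
      unfolding assms(3) by (intro reducts_isomorphic_imp_craig assms(4) ff(2)) auto
  qed
qed

end
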